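(* Let $\mathcal{A}$ be a $C^*$-algebra, let $\mathcal{M},\mathcal{N}$ be Hilbert $C^*$-modules over $\mathcal{A}$, let $F:\mathcal{M}\to\mathcal{N}$ be a bounded $\mathcal{A}$-linear operator and let $B$ be the unit ball of $\mathcal{M}$. Then $F$ is Banach-compact if and only if $F(B)$ is $\mathcal{A}$-precompact in $\mathcal{N}$. Respectively, if $F:\mathcal{M}\to\mathcal{N}$ is an adjointable $\mathcal{A}$-linear operator, then $F$ is $\mathcal{A}$-compact if and only if $F(B)$ is $\mathcal{A}$-precompact in $\mathcal{N}$.
   Context: Hilbert $C^*$-modules are right Hilbert modules with $\langle x,ya\rangle=\langle x,y\rangle a$. $\mathcal{M}'$ is the set of bounded $\mathcal{A}$-linear maps $\mathcal{M}\to\mathcal{A}$. For $x\in\mathcal{N}$, $f\in\mathcal{M}'$ let $\theta_{x,f}:\mathcal{M}\to\mathcal{N}$, $\theta_{x,f}(z)=x\,f(z)$. The Banach-compact operators $\mathcal{M}\to\mathcal{N}$ are the elements of the operator-norm closure of the linear span of all $\theta_{x,f}$ in the space of bounded $\mathcal{A}$-linear operators. The $\mathcal{A}$-compact operators are the elements of the norm closure of the linear span of those $\theta_{x,f}$ with $f=\langle y,\cdot\rangle$ for some $y\in\mathcal{M}$. A bounded subset $Z\subset\mathcal{N}$ is $\mathcal{A}$-precompact if for every $\varepsilon>0$ there exist $M_\varepsilon>0$ and $z_1,\dots,z_s\in\mathcal{N}$ such that for every $x\in Z$ there exist $a_1,\dots,a_s\in\mathcal{A}$ with $\|a_k\|\le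 M_\varepsilon$ and $\|x-\sum_{k=1}^sz_ka_k\|<\varepsilon$. *)

theory Defs
  imports "HOL-Analysis.Analysis"
begin

class complex_vector = real_vector +
  fixes scaleC :: "complex \<Rightarrow> 'a \<Rightarrow> 'a"  (infixr \<open>*\<^sub>C\<close> 75)
  assumes scaleC_of_real: "complex_of_real r *\<^sub>C x = r *\<^sub>R x"
    and scaleC_add_right: "c *\<^sub>C (x + y) = c *\<^sub>C x + c *\<^sub>C y"
    and scaleC_add_left: "(c + d) *\<^sub>C x = c *\<^sub>C x + d *\<^sub>C x"
    and scaleC_scaleC: "c *\<^sub>C (d *\<^sub>C x) = (c * d) *\<^sub>C x"

lemma scaleC_one: "1 *\<^sub>C x = (x::'a::complex_vector)"
  using scaleC_of_real[of 1 x] by simp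

lemma scaleC_scaleR: "c *\<^sub>C (r *\<^sub>R x) = r *\<^sub>R (c *\<^sub>C (x::'a::complex_vector))"
  by (metis scaleC_of_real scaleC_scaleC mult.commute)

global_interpretation complex_vector:
  vector_space "scaleC :: complex \<Rightarrow> 'a \<Rightarrow> 'a::complex_vector"
  defines cspan = complex_vector.span
  by unfold_locales (simp_all add: scaleC_add_right scaleC_add_left scaleC_scaleC scaleC_one)

class complex_normed_vector = complex_vector + real_normed_vector +
  assumes norm_scaleC: "norm (c *\<^sub>C x) = cmod c * norm x"

class complex_banach = complex_normed_vector + banach

lemma bounded_linear_scaleC:
  "bounded_linear (\<lambda>x::'a::complex_normed_vector. c *\<^sub>C x)"
  by (rule bounded_linear_intro[where K = "cmod c"])
    (simp_all add: scaleC_add_right scaleC_scaleR norm_scaleC mult.commute)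

text \<open>No unit is required, and the zero algebra is allowed.\<close>

class cstar_algebra = complex_banach + real_normed_algebra +
  fixes star :: "'a \<Rightarrow> 'a"
  assumes mult_scaleC_left: "(c *\<^sub>C a) * b = c *\<^sub>C (a * b)"
    and mult_scaleC_right: "a * (c *\<^sub>C b) = c *\<^sub>C (a * b)"
    and star_add: "star (a + b) = star a + star b"
    and star_scaleC: "star (c *\<^sub>C a) = cnj c *\<^sub>C star a"
    and star_mult: "star (a * b) = star b * star a"
    and star_star: "star (star a) = a"
    and cstar_identity: "norm (star a * a) = (norm a)\<^sup>2"

lemma norm_star: "norm (star a) = norm (a::'a::cstar_algebra)"
proof -
  have le: "norm b \<le> norm (star b)" for b :: 'a
  proof (cases "norm b = 0")
    case False
    have "norm b * norm b \<le> norm (star b) * norm b"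
      using cstar_identity[of b] norm_mult_ineq[of "star b" b] by (simp add: power2_eq_square)
    then show ?thesis using False by simp
  qed simp
  show ?thesis using le[of a] le[of "star a"] by (simp add: star_star)
qed

definition cstar_positive :: "'a::cstar_algebra \<Rightarrow> bool" where
  "cstar_positive a \<longleftrightarrow> (\<exists>b. a = star b * b)"

text \<open>
  Right Hilbert modules, with the inner product conjugate-linear in the first argument.
  The norm of the underlying Banach space is the one induced by the inner product, so
  definiteness of the inner product follows from \<open>norm_eq\<close>, and completeness from the
  class \<^class>\<open>complex_banach\<close>.
\<close>

locale hilbert_cstar_module =
  fixes act :: "'m::complex_banach \<Rightarrow> 'a::cstar_algebra \<Rightarrow> 'm"
    and ip :: "'m \<Rightarrow> 'm \<Rightarrow> 'a"
  assumes act_add_left: "act (x + y) a = act x a + act y a"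
    and act_add_right: "act x (a + b) = act x a + act x b"
    and act_mult: "act x (a * b) = act (act x a) b"
    and act_scaleC_left: "act (c *\<^sub>C x) a = c *\<^sub>C act x a"
    and act_scaleC_right: "act x (c *\<^sub>C a) = c *\<^sub>C act x a"
    and ip_add_right: "ip x (y + z) = ip x y + ip x z"
    and ip_scaleC_right: "ip x (c *\<^sub>C y) = c *\<^sub>C ip x y"
    and ip_act_right: "ip x (act y a) = ip x y * a"
    and ip_star: "star (ip x y) = ip y x"
    and ip_positive: "cstar_positive (ip x x)"
    and norm_eq: "norm x = sqrt (norm (ip x x))"
begin

lemma ip_act_left: "ip (act x a) y = star a * ip x y"
  by (metis ip_act_right ip_star star_mult)

lemma norm_act_le: "norm (act x a) \<le> norm x * norm a"
proof -
  have "norm (ip (act x a) (act x a)) = norm (star a * (ip x x * a))"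
    by (simp add: ip_act_left ip_act_right mult.assoc)
  also have "\<dots> \<le> norm (star a) * norm (ip x x * a)"
    by (rule norm_mult_ineq)
  also have "\<dots> \<le> norm (star a) * (norm (ip x x) * norm a)"
    by (rule mult_left_mono[OF norm_mult_ineq norm_ge_zero])
  also have "\<dots> = norm (ip x x) * (norm a)\<^sup>2"
    by (simp add: norm_star power2_eq_square)
  finally show ?thesis
    unfolding norm_eq[of "act x a"] norm_eq[of x]
    by (metis norm_ge_zero real_sqrt_le_mono real_sqrt_mult real_sqrt_abs abs_of_nonneg)
qed

lemma bounded_linear_act: "bounded_linear (act x)"
proof (rule bounded_linear_intro[where K = "norm x"])
  show "act x (r *\<^sub>R a) = r *\<^sub>R act x a" for r a
    by (metis act_scaleC_right scaleC_of_real)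
qed (simp_all add: act_add_right norm_act_le mult.commute[of _ "norm x"])

end

text \<open>
  Module maps are complex linear as well; the algebra is a right module over itself
  through its multiplication.
\<close>

definition A_linear ::
  "('m::complex_vector \<Rightarrow> 'a \<Rightarrow> 'm) \<Rightarrow> ('n::complex_vector \<Rightarrow> 'a \<Rightarrow> 'n) \<Rightarrow> ('m \<Rightarrow> 'n) \<Rightarrow> bool"
where
  "A_linear actM actN F \<longleftrightarrow>
     (\<forall>x y. F (x + y) = F x + F y) \<and>
     (\<forall>c x. F (c *\<^sub>C x) = c *\<^sub>C F x) \<and>
     (\<forall>x a. F (actM x a) = actN (F x) a)"

definition adjointable ::
  "('m \<Rightarrow> 'm \<Rightarrow> 'a) \<Rightarrow> ('n \<Rightarrow> 'n \<Rightarrow> 'a) \<Rightarrow> ('m \<Rightarrow> 'n) \<Rightarrow> bool"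
where
  "adjointable ipM ipN F \<longleftrightarrow> (\<exists>G. \<forall>x y. ipN (F x) y = ipM x (G y))"

definition module_dual ::
  "('m::complex_banach \<Rightarrow> 'a::cstar_algebra \<Rightarrow> 'm) \<Rightarrow> ('m \<Rightarrow>\<^sub>L 'a) set"
where
  "module_dual actM = {f. A_linear actM (*) (blinfun_apply f)}"

text \<open>
  The space \<open>'m \<Rightarrow>\<^sub>L 'n\<close> of bounded real-linear maps carries the operator norm; the
  bounded module maps form a subset of it.
\<close>

instantiation blinfun :: (real_normed_vector, complex_normed_vector) complex_vector
begin

lift_definition scaleC_blinfun :: "complex \<Rightarrow> 'a \<Rightarrow>\<^sub>L 'b \<Rightarrow> 'a \<Rightarrow>\<^sub>L 'b" is
  "\<lambda>c T x. c *\<^sub>C T x"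
  by (rule bounded_linear_compose[OF bounded_linear_scaleC])

instance
  by standard
    (transfer, simp add: fun_eq_iff scaleC_of_real scaleC_add_right scaleC_add_left scaleC_scaleC)+

end

definition theta ::
  "('n::complex_banach \<Rightarrow> 'a::cstar_algebra \<Rightarrow> 'n) \<Rightarrow> 'n \<Rightarrow> ('m::complex_banach \<Rightarrow>\<^sub>L 'a) \<Rightarrow> 'm \<Rightarrow>\<^sub>L 'n"
where
  "theta actN x f = Blinfun (\<lambda>z. actN x (blinfun_apply f z))"

lemma (in hilbert_cstar_module) theta_apply:
  "blinfun_apply (theta act x f) z = act x (blinfun_apply f z)"
  unfolding theta_def
  by (simp add: bounded_linear_Blinfun_apply
      bounded_linear_compose[OF bounded_linear_act blinfun.bounded_linear_right])

definition banach_compact ::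
  "('m::complex_banach \<Rightarrow> 'a::cstar_algebra \<Rightarrow> 'm) \<Rightarrow> ('n::complex_banach \<Rightarrow> 'a \<Rightarrow> 'n) \<Rightarrow>
    ('m \<Rightarrow> 'n) \<Rightarrow> bool"
where
  "banach_compact actM actN F \<longleftrightarrow>
     (\<exists>T. F = blinfun_apply T \<and> A_linear actM actN F \<and>
        T \<in> closure (cspan {theta actN x f | x f. f \<in> module_dual actM}))"

definition A_compact ::
  "('m::complex_banach \<Rightarrow> 'a::cstar_algebra \<Rightarrow> 'm) \<Rightarrow> ('m \<Rightarrow> 'm \<Rightarrow> 'a) \<Rightarrow>
    ('n::complex_banach \<Rightarrow> 'a \<Rightarrow> 'n) \<Rightarrow> ('m \<Rightarrow> 'n) \<Rightarrow> bool"
where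
  "A_compact actM ipM actN F \<longleftrightarrow>
     (\<exists>T. F = blinfun_apply T \<and> A_linear actM actN F \<and>
        T \<in> closure (cspan {theta actN x f | x f.
              f \<in> module_dual actM \<and> (\<exists>y. blinfun_apply f = ipM y)}))"

definition A_precompact ::
  "('n::complex_banach \<Rightarrow> 'a::cstar_algebra \<Rightarrow> 'n) \<Rightarrow> 'n set \<Rightarrow> bool"
where
  "A_precompact actN Z \<longleftrightarrow> bounded Z \<and>
     (\<forall>\<epsilon>>0. \<exists>M>0. \<exists>(s::nat) z. \<forall>x\<in>Z. \<exists>a.
        (\<forall>k\<in>{1..s}. norm (a k) \<le> M) \<and>
        norm (x - (\<Sum>k=1..s. actN (z k) (a k))) < \<epsilon>)"

end

theory Submission imports Defs begin

text \<open>
  For a Banach-compact \<open>F\<close>, an approximating finite sum of operators \<open>\<theta>\<^bsub>x,f\<^esub>\<close> has on the unit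
  ball the values \<open>\<Sum> x f(u)\<close>, with coefficients \<open>f(u)\<close> bounded by the norms of the
  functionals. Hence the image of the ball is precompact. An \<open>\<A>\<close>-compact operator is
  Banach-compact, so this settles one direction in both cases.

  Conversely, let \<open>F(B)\<close> be close to combinations of \<open>z\<^sub>1, \<dots>, z\<^sub>s\<close> with coefficients of norm at
  most \<open>M\<close>. The core of the proof is a finite-rank operator \<open>P u = \<Sum> x\<^sub>k \<langle>y\<^sub>k,u\<rangle>\<close> on the target module
  such that \<open>1 - P\<close> is a contraction and \<open>z\<^sub>k - P z\<^sub>k\<close> is as small as desired
  (\<open>finite_rank_approximate_identity\<close>). Being a contraction, \<open>1 - P\<close> preserves the smallness of
  the distance from \<open>F u\<close> to \<open>\<Sum> z\<^sub>k a\<^sub>k\<close>; being a module map, it sends that combination to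
  \<open>\<Sum> (z\<^sub>k - P z\<^sub>k) a\<^sub>k\<close>, which is small because \<open>M\<close> is known before the accuracy of \<open>P\<close> is chosen. So
  \<open>P F\<close> approximates \<open>F\<close> uniformly on the ball. It is the sum of the operators \<open>\<theta>\<close> built from
  \<open>x\<^sub>k\<close> and the bounded functional \<open>\<langle>y\<^sub>k, F \<cdot>\<rangle>\<close>, and this functional is \<open>\<langle>G y\<^sub>k, \<cdot>\<rangle>\<close> if \<open>F\<close> has an
  adjoint \<open>G\<close>.

  For a single vector \<open>z\<close> the contraction \<open>1 - P\<close> is the resolvent \<open>d (d - J)\<inverse>\<close> with small \<open>d > 0\<close>,
  where \<open>J u = \<i> z \<langle>z,u\<rangle>\<close> (\<open>contraction_almost_annihilating\<close>). Since \<open>J\<close> is skew-adjoint,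
  \<open>d x - J x\<close> and \<open>d x + J x\<close> have the same inner square, and all norm estimates follow from this
  identity. Several vectors are treated one at a time by composing such contractions.
\<close>

section \<open>Calculus in Hilbert modules\<close>

context hilbert_cstar_module
begin

lemma ip_add_left: "ip (x + y) z = ip x z + ip y z"
  by (metis ip_add_right ip_star star_add)

lemma ip_scaleC_left: "ip (c *\<^sub>C x) y = cnj c *\<^sub>C ip x y"
  by (metis ip_scaleC_right ip_star star_scaleC)

lemma ip_scaleR_right: "ip x (r *\<^sub>R y) = r *\<^sub>R ip x y"
  by (metis ip_scaleC_right scaleC_of_real)

lemma ip_scaleR_left: "ip (r *\<^sub>R x) y = r *\<^sub>R ip x y"
  by (metis complex_cnj_complex_of_real ip_scaleC_left scaleC_of_real)

lemma ip_minus_right: "ip x (- y) = - ip x y"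
  using ip_scaleR_right[of x "-1" y] by simp

lemma ip_minus_left: "ip (- x) y = - ip x y"
  using ip_scaleR_left[of "-1" x y] by simp

lemma ip_diff_right: "ip x (y - z) = ip x y - ip x z"
  using ip_add_right[of x y "- z"] by (simp add: ip_minus_right)

lemma act_minus_left: "act (- x) a = - act x a"
  using act_add_left[of x "- x" a] act_add_left[of 0 0 a] by (simp add: eq_neg_iff_add_eq_0 add.commute)

lemma act_diff_left: "act (x - y) a = act x a - act y a"
  using act_add_left[of x "- y" a] by (simp add: act_minus_left)

lemma act_sum_left: "act (sum f I) a = (\<Sum>i\<in>I. act (f i) a)"
  using act_add_left[of 0 0 a]
  by (induction I rule: infinite_finite_induct) (simp_all add: act_add_left)

lemma act_diff_right: "act x (a - b) = act x a - act x b"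
  by (rule linear_diff[OF bounded_linear.linear[OF bounded_linear_act]])

lemma norm_ip_self: "norm (ip x x) = (norm x)\<^sup>2"
  by (simp add: norm_eq[of x])

text \<open>
  This is the Cauchy--Schwarz inequality up to a constant: polarization expresses \<open>4 \<langle>x,y\<rangle>\<close> by
  four inner squares, whose norms are bounded by the triangle inequality. The constant only
  affects the choice of \<open>d\<close> in terms of \<open>\<eta>\<close> below.
\<close>

lemma norm_ip_le: "norm (ip x y) \<le> 4 * (norm x * norm y)"
proof -
  have unit: "norm (ip x y) \<le> 4" if "norm x \<le> 1" "norm y \<le> 1" for x y
  proof -
    have *: "norm (ip (x + c *\<^sub>C y) (x + c *\<^sub>C y)) \<le> 4" if "cmod c = 1" for c
    proof -
      have "norm (x + c *\<^sub>C y) \<le> 2"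
        using norm_triangle_ineq[of x "c *\<^sub>C y"] that \<open>norm x \<le> 1\<close> \<open>norm y \<le> 1\<close>
        by (simp add: norm_scaleC)
      then have "(norm (x + c *\<^sub>C y))\<^sup>2 \<le> 2\<^sup>2"
        by (intro power_mono) auto
      then show ?thesis by (simp add: norm_ip_self)
    qed
    define q where "q c = cnj c *\<^sub>C ip (x + c *\<^sub>C y) (x + c *\<^sub>C y)" for c
    have q_le: "norm (q c) \<le> 4" if "cmod c = 1" for c
      using *[OF that] that by (simp add: q_def norm_scaleC)
    have q: "q c = cnj c *\<^sub>C (ip x x + (c * cnj c) *\<^sub>C ip y y) + (cnj c * c) *\<^sub>C ip x y
        + (cnj c * cnj c) *\<^sub>C ip y x" for c
      by (simp add: q_def ip_add_left ip_add_right ip_scaleC_left ip_scaleC_right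
          scaleC_add_right scaleC_scaleC algebra_simps)
    have neg: "(- c) *\<^sub>C a = - (c *\<^sub>C a)" for c and a :: 'a
      by (rule complex_vector.scale_minus_left)
    have four: "4 *\<^sub>R a = a + (a + (a + a))" for a :: 'a
      using scaleR_add_left[of 2 2 a] by (simp add: scaleR_2 add.assoc)
    have "q 1 + q (-1) + q \<i> + q (- \<i>) = 4 *\<^sub>R ip x y"
      by (simp add: q neg scaleC_one scaleC_add_right algebra_simps four)
    then have "4 * norm (ip x y) = norm (q 1 + q (-1) + q \<i> + q (- \<i>))"
      by simp
    also have "\<dots> \<le> norm (q 1) + norm (q (-1)) + norm (q \<i>) + norm (q (- \<i>))"
      by (intro norm_triangle_mono order_refl)
    also have "\<dots> \<le> 16"
      using q_le[of 1] q_le[of "-1"] q_le[of \<i>] q_le[of "- \<i>"] by simp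
    finally show ?thesis by simp
  qed
  show ?thesis
  proof (cases "x = 0 \<or> y = 0")
    case True
    then show ?thesis
      using ip_scaleR_left[of 0 x y] ip_scaleR_right[of x 0 y] by auto
  next
    case False
    then have "norm (ip (inverse (norm x) *\<^sub>R x) (inverse (norm y) *\<^sub>R y)) \<le> 4"
      by (intro unit) auto
    then show ?thesis
      using False by (simp add: ip_scaleR_left ip_scaleR_right field_simps)
  qed
qed

lemma bounded_linear_ip: "bounded_linear (ip x)"
proof (rule bounded_linear_intro[where K = "4 * norm x"])
  show "norm (ip x y) \<le> norm y * (4 * norm x)" for y
    using norm_ip_le[of x y] by (simp add: mult_ac)
qed (simp_all add: ip_add_right ip_scaleR_right)

section \<open>Resolvents of skew-adjoint operators\<close>

text \<open>
  For skew-adjoint \<open>J\<close> the mixed terms cancel, so the signs of \<open>a\<close> and \<open>b\<close> are irrelevant.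
\<close>

lemma ip_skew:
  assumes skew: "\<And>x y. ip (J x) y = - ip x (J y)"
  shows "ip (a *\<^sub>R x + b *\<^sub>R J x) (a *\<^sub>R x + b *\<^sub>R J x) =
    a\<^sup>2 *\<^sub>R ip x x + b\<^sup>2 *\<^sub>R ip (J x) (J x)"
  using skew[of x x]
  by (simp add: ip_add_left ip_add_right ip_scaleR_left ip_scaleR_right power2_eq_square
      algebra_simps)

lemma norm_skew_eq:
  assumes skew: "\<And>x y. ip (J x) y = - ip x (J y)"
  shows "norm (d *\<^sub>R x - J x) = norm (d *\<^sub>R x + J x)"
  using ip_skew[of J d x 1, OF skew] ip_skew[of J d x "-1", OF skew]
  by (simp add: norm_eq[of "d *\<^sub>R x - J x"] norm_eq[of "d *\<^sub>R x + J x"])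

lemma norm_le_skew:
  assumes skew: "\<And>x y. ip (J x) y = - ip x (J y)"
  shows "norm (d *\<^sub>R x) \<le> norm (d *\<^sub>R x - J x)" "norm (J x) \<le> norm (d *\<^sub>R x - J x)"
proof -
  have "2 *\<^sub>R (d *\<^sub>R x) = (d *\<^sub>R x + J x) + (d *\<^sub>R x - J x)"
    by (simp add: algebra_simps flip: scaleR_add_left)
  then have "norm (2 *\<^sub>R (d *\<^sub>R x)) \<le> norm (d *\<^sub>R x + J x) + norm (d *\<^sub>R x - J x)"
    by (simp only: norm_triangle_ineq)
  then show "norm (d *\<^sub>R x) \<le> norm (d *\<^sub>R x - J x)"
    by (simp add: norm_skew_eq[of J, OF skew])
  have "2 *\<^sub>R J x = (d *\<^sub>R x + J x) - (d *\<^sub>R x - J x)"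
    by (simp add: scaleR_2)
  then have "norm (2 *\<^sub>R J x) \<le> norm (d *\<^sub>R x + J x) + norm (d *\<^sub>R x - J x)"
    by (simp only: norm_triangle_ineq4)
  then show "norm (J x) \<le> norm (d *\<^sub>R x - J x)"
    by (simp add: norm_skew_eq[of J, OF skew])
qed

text \<open>
  The equation \<open>d x - J x = y\<close> is solved by damped iteration of \<open>x \<mapsto> x - t (d x - J x - y)\<close>.
  By the cancellation of mixed terms this map has squared Lipschitz constant at most
  \<open>(1 - t d)\<^sup>2 + t\<^sup>2 K\<^sup>2\<close>, where \<open>K\<close> bounds \<open>J\<close>; the value of \<open>t\<close> minimizes it.
\<close>

lemma skew_resolvent:
  assumes J: "bounded_linear J" and skew: "\<And>x y. ip (J x) y = - ip x (J y)" and d: "d > 0"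
  obtains x where "d *\<^sub>R x - J x = y"
proof -
  interpret J: bounded_linear J by (rule J)
  obtain K where K: "\<And>x. norm (J x) \<le> norm x * K" "K > 0"
    using J.pos_bounded by blast
  define t where "t = d / (d\<^sup>2 + K\<^sup>2)"
  define c where "c = sqrt (K\<^sup>2 / (d\<^sup>2 + K\<^sup>2))"
  have pos: "d\<^sup>2 + K\<^sup>2 > 0" using d by (simp add: sum_power2_gt_zero_iff)
  have t: "t > 0" using d pos by (simp add: t_def)
  have c: "0 \<le> c" "c < 1" using d pos by (simp_all add: c_def)
  have c2: "(1 - t * d)\<^sup>2 + t\<^sup>2 * K\<^sup>2 = c\<^sup>2"
  proof -
    have "1 - d / D * d = k / D" if "D = d * d + k" "D > 0" for D k
      using that by (simp add: field_simps)
    from this[of "d\<^sup>2 + K\<^sup>2" "K\<^sup>2"] have td: "1 - t * d = K\<^sup>2 / (d\<^sup>2 + K\<^sup>2)"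
      using pos by (simp add: t_def power2_eq_square)
    have "(1 - t * d)\<^sup>2 + t\<^sup>2 * K\<^sup>2 = (K\<^sup>2 * (d\<^sup>2 + K\<^sup>2)) / (d\<^sup>2 + K\<^sup>2)\<^sup>2"
      unfolding td unfolding t_def power_divide
      by (simp add: add_divide_distrib[symmetric] algebra_simps power2_eq_square)
    also have "\<dots> = c\<^sup>2" using pos by (simp add: c_def power2_eq_square)
    finally show ?thesis .
  qed
  define g where "g x = x - t *\<^sub>R (d *\<^sub>R x - J x - y)" for x
  have "dist (g x) (g x') \<le> c * dist x x'" for x x'
  proof -
    define h where "h = x - x'"
    have "g x - g x' = (1 - t * d) *\<^sub>R h + t *\<^sub>R J h"
      by (simp add: g_def h_def J.diff algebra_simps)
    then have "(norm (g x - g x'))\<^sup>2 = norm ((1 - t * d)\<^sup>2 *\<^sub>R ip h h + t\<^sup>2 *\<^sub>R ip (J h) (J h))"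
      by (simp add: norm_ip_self[symmetric] ip_skew[OF skew])
    also have "\<dots> \<le> (1 - t * d)\<^sup>2 * (norm h)\<^sup>2 + t\<^sup>2 * (norm (J h))\<^sup>2"
      by (rule norm_triangle_le) (simp add: norm_ip_self)
    also have "\<dots> \<le> (1 - t * d)\<^sup>2 * (norm h)\<^sup>2 + t\<^sup>2 * (norm h * K)\<^sup>2"
      by (intro add_mono mult_left_mono power_mono K) auto
    also have "\<dots> = ((1 - t * d)\<^sup>2 + t\<^sup>2 * K\<^sup>2) * (norm h)\<^sup>2"
      by (simp add: algebra_simps)
    also have "\<dots> = (c * norm h)\<^sup>2"
      by (simp only: c2 power_mult_distrib)
    finally have "norm (g x - g x') \<le> c * norm h"
      by (rule power2_le_imp_le) (simp add: c)
    then show ?thesis by (simp add: dist_norm h_def)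
  qed
  then obtain x where "g x = x"
    using banach_fix_type[of c g, OF c] by metis
  then have "d *\<^sub>R x - J x = y" using t by (simp add: g_def)
  then show thesis by (rule that)
qed

section \<open>Contractions that almost annihilate given vectors\<close>

text \<open>
  The contraction is \<open>R = d (d - J)\<inverse>\<close> with \<open>J u = \<i> z \<langle>z,u\<rangle>\<close>, which differs from the
  identity by an elementary operator since \<open>R - 1 = J (d - J)\<inverse>\<close>. Heuristically, with
  \<open>b = \<langle>z,z\<rangle>\<close> treated as a number, \<open>R z\<close> is \<open>z\<close> times \<open>d / (d - \<i> b)\<close>, and its inner square
  \<open>b d\<^sup>2 / (d\<^sup>2 + b\<^sup>2)\<close> is at most \<open>d\<close>. So the norm of \<open>R z\<close> is at most of order \<open>sqrt d\<close>. The
  rigorous bound estimates \<open>w \<langle>w,w\<rangle>\<close> for \<open>w = R z\<close>: with \<open>p = R\<^sup>* w\<close> it equals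
  \<open>R (z \<langle>z,p\<rangle>)\<close>, which is \<open>R J p\<close> up to a unimodular factor, and
  \<open>R J = d J (d - J)\<inverse>\<close> has norm at most \<open>d\<close>. An imaginary
  factor in \<open>J\<close>, rather than the usual \<open>d (d + \<theta>)\<inverse>\<close> with \<open>\<theta> u = z \<langle>z,u\<rangle>\<close>, makes invertibility
  and contractivity consequences of skew-adjointness.
\<close>

lemma contraction_almost_annihilating:
  assumes "\<eta> > 0"
  obtains y where "\<And>u. norm (u - act z (ip y u)) \<le> norm u"
    and "norm (z - act z (ip y z)) \<le> \<eta>"
proof -
  define J where "J u = \<i> *\<^sub>C act z (ip z u)" for u
  have J: "bounded_linear J"
    unfolding J_def
    by (intro bounded_linear_compose[OF bounded_linear_scaleC]
        bounded_linear_compose[OF bounded_linear_act] bounded_linear_ip)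
  interpret J: bounded_linear J by (rule J)
  have scaleC_minus: "(- c) *\<^sub>C a = - (c *\<^sub>C a)" for c and a :: 'a
    by (rule complex_vector.scale_minus_left)
  have skew: "ip (J x) y = - ip x (J y)" for x y
    by (simp add: J_def ip_scaleC_left ip_scaleC_right ip_act_left ip_act_right ip_star
        scaleC_minus)
  define d where "d = \<eta>\<^sup>2 / 4"
  have d: "d > 0" using assms by (simp add: d_def)
  have skew': "ip (- J x) y = - ip x (- J y)" for x y
    by (simp add: ip_minus_left ip_minus_right skew)
  obtain v where v: "d *\<^sub>R v + J v = z"
    using skew_resolvent[of "\<lambda>x. - J x" d z, OF bounded_linear_minus[OF J] skew' d] by auto
  define y where "y = \<i> *\<^sub>C v"
  define R where "R u = u - act z (ip y u)" for u
  have R_act: "R (act u a) = act (R u) a" for u a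
    by (simp add: R_def ip_act_right act_mult act_diff_left)
  have R_scaleC: "R (c *\<^sub>C u) = c *\<^sub>C R u" for c u
    by (simp add: R_def ip_scaleC_right act_scaleC_right complex_vector.scale_right_diff_distrib)
  have R: "R (d *\<^sub>R x - J x) = d *\<^sub>R x" for x
  proof -
    \<comment> \<open>The vector \<open>v\<close> is \<open>z\<close> under the adjoint of \<open>(d - J)\<inverse>\<close>.\<close>
    have "ip v (d *\<^sub>R x - J x) = ip (d *\<^sub>R v + J v) x"
      by (simp add: ip_diff_right ip_add_left ip_scaleR_left ip_scaleR_right skew)
    then have "ip y (d *\<^sub>R x - J x) = (- \<i>) *\<^sub>C ip z x"
      by (simp add: y_def ip_scaleC_left v)
    then have "act z (ip y (d *\<^sub>R x - J x)) = (- \<i>) *\<^sub>C act z (ip z x)"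
      by (simp only: act_scaleC_right)
    also have "\<dots> = - J x"
      by (simp add: J_def complex_vector.scale_minus_left)
    finally show ?thesis by (simp add: R_def)
  qed
  have R_le: "norm (R u) \<le> norm u" for u
  proof -
    obtain x where "d *\<^sub>R x - J x = u" using skew_resolvent[OF J skew d] .
    then show ?thesis using norm_le_skew(1)[of J d x, OF skew] R[of x] by simp
  qed
  have R_J_le: "norm (R (J u)) \<le> d * norm u" for u
  proof -
    obtain x where x: "d *\<^sub>R x - J x = u" using skew_resolvent[OF J skew d] .
    have "J u = d *\<^sub>R J x - J (J x)"
      by (simp add: x[symmetric] J.diff J.scaleR)
    then have "norm (R (J u)) = d * norm (J x)"
      using R[of "J x"] d by simp
    then show ?thesis
      using norm_le_skew(2)[of J x d, OF skew] d by (simp add: x)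
  qed
  define w where "w = R z"
  \<comment> \<open>\<open>p\<close> is the image of \<open>w\<close> under the adjoint \<open>d (d + J)\<inverse>\<close> of \<open>R\<close>.\<close>
  obtain x' where x': "d *\<^sub>R x' + J x' = w"
    using skew_resolvent[of "\<lambda>x. - J x" d w, OF bounded_linear_minus[OF J] skew' d] by auto
  define p where "p = d *\<^sub>R x'"
  have p_le: "norm p \<le> norm w"
    using norm_le_skew(1)[of J d x', OF skew] norm_skew_eq[of J d x', OF skew]
    by (simp add: p_def x')
  have ww: "ip w w = ip z p"
  proof -
    obtain x where x: "d *\<^sub>R x - J x = z" using skew_resolvent[OF J skew d] .
    have w: "w = d *\<^sub>R x" using R[of x] by (simp add: w_def x)
    have "ip w w = ip (d *\<^sub>R x' + J x') (d *\<^sub>R x)" by (simp only: x' w)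
    also have "\<dots> = ip p z"
      by (simp add: p_def x[symmetric] ip_diff_right ip_add_left ip_scaleR_left ip_scaleR_right skew
          algebra_simps)
    finally show ?thesis by (metis ip_star)
  qed
  have "norm (act w (ip w w)) = norm (R (act z (ip z p)))"
    unfolding ww by (simp add: w_def R_act)
  also have "\<dots> = norm (R (J p))"
    by (simp add: J_def R_scaleC norm_scaleC)
  also have "\<dots> \<le> d * norm p" by (rule R_J_le)
  also have "\<dots> \<le> d * norm w" using p_le d by simp
  finally have small: "norm (act w (ip w w)) \<le> d * norm w" .
  have "((norm w)\<^sup>2)\<^sup>2 = norm (ip w w * ip w w)"
    using cstar_identity[of "ip w w"] by (simp add: ip_star norm_ip_self)
  also have "\<dots> = norm (ip w (act w (ip w w)))" by (simp add: ip_act_right)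
  also have "\<dots> \<le> 4 * (norm w * (d * norm w))"
    by (rule order_trans[OF norm_ip_le]) (simp add: mult_left_mono[OF small])
  finally have "(norm w)\<^sup>2 * (norm w)\<^sup>2 \<le> \<eta>\<^sup>2 * (norm w)\<^sup>2"
    by (simp add: d_def power2_eq_square mult_ac)
  then have "w = 0 \<or> (norm w)\<^sup>2 \<le> \<eta>\<^sup>2"
    by (simp only: mult_le_cancel_right) auto
  then have "norm w \<le> \<eta>"
    using assms by (auto intro: power2_le_imp_le)
  then show thesis
    using that[of y] R_le by (simp add: R_def w_def)
qed

text \<open>
  The first contraction is built for the last vector, and the induction hypothesis is applied to
  the images of the others under it. The composite then annihilates all vectors approximately
  because the second factor does not increase norms.
\<close>

lemma finite_rank_approximate_identity:
  fixes s :: nat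
  assumes "\<eta> > 0"
  shows "\<exists>x y. (\<forall>u. norm (u - (\<Sum>k=1..s. act (x k) (ip (y k) u))) \<le> norm u) \<and>
    (\<forall>j\<in>{1..s}. norm (z j - (\<Sum>k=1..s. act (x k) (ip (y k) (z j)))) \<le> \<eta>)"
proof (induction s arbitrary: z)
  case 0
  then show ?case by simp
next
  case (Suc s)
  define e where "e = z (Suc s)"
  obtain v where v: "\<And>u. norm (u - act e (ip v u)) \<le> norm u" "norm (e - act e (ip v e)) \<le> \<eta>"
    using contraction_almost_annihilating[OF assms, of e] by blast
  define Q where "Q u = u - act e (ip v u)" for u
  obtain x y where
    xy: "\<And>u. norm (u - (\<Sum>k=1..s. act (x k) (ip (y k) u))) \<le> norm u"
      "\<And>j. j \<in> {1..s} \<Longrightarrow> norm (Q (z j) - (\<Sum>k=1..s. act (x k) (ip (y k) (Q (z j))))) \<le> \<eta>"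
    using Suc.IH[of "\<lambda>j. Q (z j)"] by blast
  define P where "P u = (\<Sum>k=1..s. act (x k) (ip (y k) u))" for u
  have P_diff: "P (u - u') = P u - P u'" for u u'
    by (simp add: P_def ip_diff_right act_diff_right sum_subtractf)
  have P_act: "P (act u a) = act (P u) a" for u a
    by (simp add: P_def ip_act_right act_mult act_sum_left)
  define x' where "x' = x(Suc s := e - P e)"
  define y' where "y' = y(Suc s := v)"
  have eq: "u - (\<Sum>k=1..Suc s. act (x' k) (ip (y' k) u)) = Q u - P (Q u)" for u
  proof -
    have "(\<Sum>k=1..Suc s. act (x' k) (ip (y' k) u)) = P u + act (e - P e) (ip v u)"
      by (simp add: x'_def y'_def P_def)
    then show ?thesis by (simp add: Q_def P_diff P_act act_diff_left)
  qed
  have "norm (Q u - P (Q u)) \<le> norm u" for u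
    using xy(1)[of "Q u"] v(1)[of u] by (simp add: P_def Q_def)
  moreover have "norm (Q (z j) - P (Q (z j))) \<le> \<eta>" if "j \<in> {1..Suc s}" for j
  proof (cases "j = Suc s")
    case True
    then show ?thesis
      using xy(1)[of "Q e"] v(2) by (simp add: P_def Q_def e_def)
  next
    case False
    then show ?thesis using xy(2)[of j] that by (simp add: P_def)
  qed
  ultimately show ?case
    by (intro exI[of _ x'] exI[of _ y']) (simp only: eq, blast)
qed

text \<open>
  The vector \<open>u\<close> is split into a combination of the \<open>z k\<close>, which the module map \<open>1 - P\<close> almost
  annihilates coefficientwise, and a remainder, which it does not enlarge.
\<close>

lemma finite_rank_approximation_near_submodule:
  assumes contr: "\<And>u. norm (u - (\<Sum>k=1..s. act (x k) (ip (y k) u))) \<le> norm u"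
    and ann: "\<And>j. j \<in> {1..s} \<Longrightarrow> norm (z j - (\<Sum>k=1..s. act (x k) (ip (y k) (z j)))) \<le> \<eta>"
    and a: "\<And>j. j \<in> {1..s} \<Longrightarrow> norm (a j) \<le> M"
  shows "norm (u - (\<Sum>k=1..s. act (x k) (ip (y k) u))) \<le>
    norm (u - (\<Sum>k=1..s. act (z k) (a k))) + real s * (\<eta> * M)"
proof -
  define Q where "Q u = u - (\<Sum>k=1..s. act (x k) (ip (y k) u))" for u
  have Q_act: "Q (act u a) = act (Q u) a" for u a
    by (simp add: Q_def ip_act_right act_mult act_sum_left act_diff_left)
  have "linear Q"
    unfolding Q_def
    by (intro linear_compose_sub linear_compose_sum linear_id[unfolded id_def] ballI
        bounded_linear.linear bounded_linear_compose[OF bounded_linear_act] bounded_linear_ip)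
  then have eq: "Q u = Q (u - (\<Sum>k=1..s. act (z k) (a k))) + (\<Sum>k=1..s. act (Q (z k)) (a k))"
    by (simp add: linear_diff linear_sum Q_act)
  have "norm (\<Sum>k=1..s. act (Q (z k)) (a k)) \<le> (\<Sum>k=1..s. \<eta> * M)"
  proof (rule sum_norm_le)
    fix k assume k: "k \<in> {1..s}"
    have "norm (Q (z k)) \<le> \<eta>" using ann[OF k] by (simp add: Q_def)
    then have "norm (Q (z k)) * norm (a k) \<le> \<eta> * M"
      using a[OF k] by (intro mult_mono) (auto intro: order_trans[OF norm_ge_zero])
    then show "norm (act (Q (z k)) (a k)) \<le> \<eta> * M"
      by (rule order_trans[OF norm_act_le])
  qed
  moreover have "norm (Q (u - (\<Sum>k=1..s. act (z k) (a k)))) \<le> norm (u - (\<Sum>k=1..s. act (z k) (a k)))"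
    unfolding Q_def by (rule contr)
  ultimately have "norm (Q u) \<le> norm (u - (\<Sum>k=1..s. act (z k) (a k))) + (\<Sum>k=1..s. \<eta> * M)"
    by (subst eq) (rule norm_triangle_mono)
  then show ?thesis by (simp add: Q_def)
qed

end

section \<open>Precompact images of the unit ball\<close>

lemma A_linear_scaleR: "A_linear actM actN F \<Longrightarrow> F (r *\<^sub>R x) = r *\<^sub>R F x"
  unfolding A_linear_def by (metis scaleC_of_real)

lemma A_linear_bound_from_ball:
  assumes F: "A_linear actM actN (F :: 'm::complex_banach \<Rightarrow> 'n::complex_banach)"
    and "\<And>x. norm x \<le> 1 \<Longrightarrow> norm (F x) \<le> C"
  shows "norm (F x) \<le> C * norm x"
proof (cases "x = 0")
  case True
  then show ?thesis using A_linear_scaleR[OF F, of 0 0] by simp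
next
  case False
  then have "norm (F (inverse (norm x) *\<^sub>R x)) \<le> C"
    by (intro assms(2)) simp
  then show ?thesis using False by (simp add: A_linear_scaleR[OF F] field_simps)
qed

lemma A_linear_bounded_linear:
  assumes F: "A_linear actM actN (F :: 'm::complex_banach \<Rightarrow> 'n::complex_banach)"
    and "bounded (F ` cball 0 1)"
  shows "bounded_linear F"
proof -
  obtain C where "\<And>x. norm x \<le> 1 \<Longrightarrow> norm (F x) \<le> C"
    using assms(2) by (force simp: bounded_iff)
  then have "norm (F x) \<le> norm x * C" for x
    using A_linear_bound_from_ball[OF F, of C] by (simp add: mult.commute)
  then show ?thesis
    using F by (intro bounded_linear_intro[of F C] A_linear_scaleR[OF F]) (auto simp: A_linear_def)
qed

text \<open>
  The functionals are \<open>\<langle>y, F \<cdot>\<rangle>\<close>, so the same approximants serve bounded and adjointable operators: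
  in the adjointable case they are given by inner products with vectors of the domain.
\<close>

lemma A_precompact_imp_closure:
  assumes "hilbert_cstar_module actN ipN"
    and F: "A_linear actM actN (F :: 'm::complex_banach \<Rightarrow> 'n::complex_banach)"
    and pre: "A_precompact actN (F ` cball 0 1)"
  shows "\<exists>T. F = blinfun_apply T \<and>
    T \<in> closure (cspan {theta actN x f | x f. f \<in> module_dual actM \<and> (\<exists>y. \<forall>u. f u = ipN y (F u))})"
    (is "\<exists>T. _ \<and> T \<in> closure (cspan ?\<Theta>)")
proof -
  interpret N: hilbert_cstar_module actN ipN by fact
  have bl: "bounded_linear F"
    using pre by (intro A_linear_bounded_linear[OF F]) (simp add: A_precompact_def)
  define T where "T = Blinfun F"
  have T: "blinfun_apply T = F" by (simp add: T_def bounded_linear_Blinfun_apply bl)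
  define f where "f y = Blinfun (\<lambda>u. ipN y (F u))" for y
  have f: "blinfun_apply (f y) = (\<lambda>u. ipN y (F u))" for y
    by (simp add: f_def bounded_linear_Blinfun_apply bounded_linear_compose[OF N.bounded_linear_ip bl])
  have f_dual: "f y \<in> module_dual actM" for y
    using F by (simp add: module_dual_def A_linear_def f N.ip_add_right N.ip_scaleC_right N.ip_act_right)
  have "\<exists>y'. \<forall>u. blinfun_apply (f y) u = ipN y' (F u)" for y
    by (auto simp: f)
  then have mem: "theta actN x (f y) \<in> ?\<Theta>" for x y
    using f_dual by blast
  have "\<exists>S\<in>cspan ?\<Theta>. dist S T < \<epsilon>" if "\<epsilon> > 0" for \<epsilon>
  proof -
    have "\<epsilon> / 4 > 0" using that by simp
    with pre obtain M and s :: nat and z where M: "M > 0"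
      and appr: "\<forall>x\<in>F ` cball 0 1. \<exists>a. (\<forall>k\<in>{1..s}. norm (a k) \<le> M) \<and>
        norm (x - (\<Sum>k=1..s. actN (z k) (a k))) < \<epsilon> / 4"
      unfolding A_precompact_def by blast
    \<comment> \<open>With \<open>s + 1\<close> instead of \<open>s\<close> the quotient is meaningful also for \<open>s = 0\<close>.\<close>
    define \<eta> where "\<eta> = \<epsilon> / (4 * (real s + 1) * M)"
    have \<eta>: "\<eta> > 0" using that M by (simp add: \<eta>_def)
    have "real s * (\<eta> * M) = \<epsilon> / 4 * (real s / (real s + 1))"
      using M by (simp add: \<eta>_def)
    also have "\<dots> \<le> \<epsilon> / 4 * 1"
      using that by (intro mult_left_mono) auto
    finally have s\<eta>: "real s * (\<eta> * M) \<le> \<epsilon> / 4" by simp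
    obtain x y where
      xy: "\<And>u. norm (u - (\<Sum>k=1..s. actN (x k) (ipN (y k) u))) \<le> norm u"
      "\<And>j. j \<in> {1..s} \<Longrightarrow> norm (z j - (\<Sum>k=1..s. actN (x k) (ipN (y k) (z j)))) \<le> \<eta>"
      using N.finite_rank_approximate_identity[OF \<eta>, of s z] by blast
    define S where "S = (\<Sum>k=1..s. theta actN (x k) (f (y k)))"
    have S: "S \<in> cspan ?\<Theta>"
      unfolding S_def
      by (intro complex_vector.span_sum complex_vector.span_base mem)
    have TS: "blinfun_apply (T - S) u = F u - (\<Sum>k=1..s. actN (x k) (ipN (y k) (F u)))" for u
      by (simp add: S_def blinfun.diff_left blinfun.sum_left N.theta_apply f T)
    have ball: "norm (blinfun_apply (T - S) u) \<le> \<epsilon> / 2" if "norm u \<le> 1" for u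
    proof -
      have Fu: "F u \<in> F ` cball 0 1" using that by simp
      obtain a where a: "\<And>k. k \<in> {1..s} \<Longrightarrow> norm (a k) \<le> M"
          "norm (F u - (\<Sum>k=1..s. actN (z k) (a k))) < \<epsilon> / 4"
        using appr Fu by blast
      have "norm (F u - (\<Sum>k=1..s. actN (x k) (ipN (y k) (F u)))) \<le>
          norm (F u - (\<Sum>k=1..s. actN (z k) (a k))) + real s * (\<eta> * M)"
        by (rule N.finite_rank_approximation_near_submodule[of x y s z \<eta> a M "F u"]) (fact xy a)+
      then show ?thesis
        using a(2) s\<eta> unfolding TS by linarith
    qed
    \<comment> \<open>Only homogeneity matters for passing from the ball to the norm, hence the trivial actions.\<close>
    have lin: "A_linear (\<lambda>u a. u) (\<lambda>v a. v) (blinfun_apply (T - S))"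
      using F unfolding A_linear_def TS
      by (auto simp: N.ip_add_right N.act_add_right N.ip_scaleC_right N.act_scaleC_right sum.distrib
          complex_vector.scale_right_diff_distrib complex_vector.scale_sum_right)
    have "norm (T - S) \<le> \<epsilon> / 2"
      by (rule norm_blinfun_bound) (use that A_linear_bound_from_ball[OF lin ball] in auto)
    then have "dist S T < \<epsilon>" using that by (simp add: dist_norm norm_minus_commute)
    with S show ?thesis by blast
  qed
  then have "T \<in> closure (cspan ?\<Theta>)" by (simp add: closure_approachable)
  then show ?thesis using T by blast
qed

text \<open>
  The coefficients are the values of the functionals, which are bounded on the ball by their
  norms. The induction appends one vector for each further summand.
\<close>

lemma cspan_theta_bounded_combination:
  assumes "hilbert_cstar_module actN ipN"
    and "S \<in> cspan {theta actN x f | x f. f \<in> module_dual (actM :: 'm::complex_banach \<Rightarrow> _)}"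
  shows "\<exists>M>0. \<exists>(s::nat) z. \<forall>u\<in>cball 0 1. \<exists>a. (\<forall>k\<in>{1..s}. norm (a k) \<le> M) \<and>
    blinfun_apply S u = (\<Sum>k=1..s. actN (z k) (a k))"
  using assms(2)
proof (induction rule: complex_vector.span_induct_alt)
  case base
  show ?case by (intro exI[of _ 1] conjI exI[of _ "0::nat"]) auto
next
  case (step c t S)
  interpret N: hilbert_cstar_module actN ipN by fact
  obtain x f where t: "t = theta actN x f" using step(1) by blast
  obtain M and s :: nat and z where M: "M > 0"
    and z: "\<And>u. u \<in> cball 0 1 \<Longrightarrow> \<exists>a. (\<forall>k\<in>{1..s}. norm (a k) \<le> M) \<and>
      blinfun_apply S u = (\<Sum>k=1..s. actN (z k) (a k))"
    using step(2) by metis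
  define M' where "M' = max M (cmod c * norm f)"
  have "\<exists>a'. (\<forall>k\<in>{1..Suc s}. norm (a' k) \<le> M') \<and>
      blinfun_apply (c *\<^sub>C t + S) u = (\<Sum>k=1..Suc s. actN ((z(Suc s := x)) k) (a' k))"
    if u: "u \<in> cball 0 1" for u
  proof -
    obtain a where a: "\<forall>k\<in>{1..s}. norm (a k) \<le> M"
        "blinfun_apply S u = (\<Sum>k=1..s. actN (z k) (a k))"
      using z[OF u] by blast
    have "norm (blinfun_apply f u) \<le> norm f * 1"
      by (rule order_trans[OF norm_blinfun mult_left_mono]) (use u in auto)
    then have "norm (c *\<^sub>C blinfun_apply f u) \<le> M'"
      by (simp add: M'_def norm_scaleC max.coboundedI2 mult_left_mono)
    moreover have "blinfun_apply (c *\<^sub>C t + S) u = actN x (c *\<^sub>C blinfun_apply f u) + blinfun_apply S u"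
      by (simp add: t blinfun.add_left scaleC_blinfun.rep_eq N.theta_apply N.act_scaleC_right)
    ultimately show ?thesis
      using a by (intro exI[of _ "a(Suc s := c *\<^sub>C blinfun_apply f u)"])
        (auto simp: M'_def max.coboundedI1 le_Suc_eq)
  qed
  moreover have "M' > 0" using M by (simp add: M'_def)
  ultimately show ?case by blast
qed

lemma banach_compact_imp_A_precompact:
  assumes "hilbert_cstar_module actN ipN" and "banach_compact actM actN F"
  shows "A_precompact actN (F ` cball 0 1)"
proof -
  obtain T where T: "F = blinfun_apply T"
    and cl: "T \<in> closure (cspan {theta actN x f | x f. f \<in> module_dual actM})"
    using assms(2) unfolding banach_compact_def by blast
  have "bounded (F ` cball 0 1)"
    unfolding T by (intro bounded_linear_image blinfun.bounded_linear_right) simp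
  moreover have "\<exists>M>0. \<exists>(s::nat) z. \<forall>x\<in>F ` cball 0 1. \<exists>a. (\<forall>k\<in>{1..s}. norm (a k) \<le> M) \<and>
        norm (x - (\<Sum>k=1..s. actN (z k) (a k))) < \<epsilon>" if \<epsilon>: "\<epsilon> > 0" for \<epsilon>
  proof -
    obtain S where S: "S \<in> cspan {theta actN x f | x f. f \<in> module_dual actM}" "dist S T < \<epsilon>"
      using cl \<epsilon> unfolding closure_approachable by blast
    obtain M and s :: nat and z where M: "M > 0"
      and z: "\<And>u. u \<in> cball 0 1 \<Longrightarrow> \<exists>a. (\<forall>k\<in>{1..s}. norm (a k) \<le> M) \<and>
        blinfun_apply S u = (\<Sum>k=1..s. actN (z k) (a k))"
      using cspan_theta_bounded_combination[OF assms(1) S(1)] by metis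
    have "norm (F u - blinfun_apply S u) < \<epsilon>" if "u \<in> cball 0 1" for u
    proof -
      have "norm (blinfun_apply (T - S) u) \<le> norm (T - S) * 1"
        by (rule order_trans[OF norm_blinfun mult_left_mono]) (use that in auto)
      then show ?thesis
        using S(2) by (simp add: T blinfun.diff_left dist_norm norm_minus_commute)
    qed
    then have "\<exists>a. (\<forall>k\<in>{1..s}. norm (a k) \<le> M) \<and>
        norm (F u - (\<Sum>k=1..s. actN (z k) (a k))) < \<epsilon>" if "u \<in> cball 0 1" for u
      using z[OF that] that by force
    with M show ?thesis by blast
  qed
  ultimately show ?thesis unfolding A_precompact_def by blast
qed

lemma A_compact_imp_banach_compact:
  assumes "A_compact actM ipM actN F"
  shows "banach_compact actM actN F"
proof -
  have "closure (cspan {theta actN x f | x f. f \<in> module_dual actM \<and> (\<exists>y. blinfun_apply f = ipM y)})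
      \<subseteq> closure (cspan {theta actN x f | x f. f \<in> module_dual actM})"
    by (intro closure_mono complex_vector.span_mono) blast
  then show ?thesis
    using assms unfolding A_compact_def banach_compact_def by blast
qed

theorem theorem4p5:
  fixes actM :: "'m::complex_banach \<Rightarrow> 'a::cstar_algebra \<Rightarrow> 'm"
    and ipM :: "'m \<Rightarrow> 'm \<Rightarrow> 'a"
    and actN :: "'n::complex_banach \<Rightarrow> 'a \<Rightarrow> 'n"
    and ipN :: "'n \<Rightarrow> 'n \<Rightarrow> 'a"
    and F :: "'m \<Rightarrow> 'n"
  assumes "hilbert_cstar_module actM ipM"
    and "hilbert_cstar_module actN ipN"
    and "A_linear actM actN F"
  shows "(bounded_linear F \<longrightarrow>
            (banach_compact actM actN F \<longleftrightarrow> A_precompact actN (F ` cball 0 1))) \<and>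
         (adjointable ipM ipN F \<longrightarrow>
            (A_compact actM ipM actN F \<longleftrightarrow> A_precompact actN (F ` cball 0 1)))"
proof (intro conjI impI iffI)
  assume "banach_compact actM actN F"
  then show "A_precompact actN (F ` cball 0 1)"
    by (rule banach_compact_imp_A_precompact[OF assms(2)])
next
  assume "A_compact actM ipM actN F"
  then show "A_precompact actN (F ` cball 0 1)"
    by (intro banach_compact_imp_A_precompact[OF assms(2)] A_compact_imp_banach_compact)
next
  assume "A_precompact actN (F ` cball 0 1)"
  then obtain T where T: "F = blinfun_apply T"
    and cl: "T \<in> closure (cspan {theta actN x f | x f.
        f \<in> module_dual actM \<and> (\<exists>y. \<forall>u. f u = ipN y (F u))})"
    using A_precompact_imp_closure[OF assms(2,3)] by blast
  have "closure (cspan {theta actN x f | x f. f \<in> module_dual actM \<and> (\<exists>y. \<forall>u. f u = ipN y (F u))})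
      \<subseteq> closure (cspan {theta actN x f | x f. f \<in> module_dual actM})"
    by (intro closure_mono complex_vector.span_mono) blast
  with T cl assms(3) show "banach_compact actM actN F"
    unfolding banach_compact_def by blast
next
  assume "adjointable ipM ipN F"
  then obtain G where G: "\<And>x y. ipN (F x) y = ipM x (G y)"
    unfolding adjointable_def by blast
  have G': "ipN y (F u) = ipM (G y) u" for y u
    by (metis G assms(1,2) hilbert_cstar_module.ip_star)
  assume "A_precompact actN (F ` cball 0 1)"
  then obtain T where T: "F = blinfun_apply T"
    and cl: "T \<in> closure (cspan {theta actN x f | x f.
        f \<in> module_dual actM \<and> (\<exists>y. \<forall>u. f u = ipN y (F u))})"
    using A_precompact_imp_closure[OF assms(2,3)] by blast
  have "closure (cspan {theta actN x f | x f. f \<in> module_dual actM \<and> (\<exists>y. \<forall>u. f u = ipN y (F u))})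
      \<subseteq> closure (cspan {theta actN x f | x f. f \<in> module_dual actM \<and> (\<exists>y. blinfun_apply f = ipM y)})"
    by (intro closure_mono complex_vector.span_mono) (auto simp: G' fun_eq_iff)
  with T cl assms(3) show "A_compact actM ipM actN F"
    unfolding A_compact_def by blast
qed

end
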